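(* Let $\mathcal R$ be a Nambu ring (with $n$-ary bracket $\{,\ldots,\}$) and let $\mathcal I$ be an ideal of $\mathcal R$. Let $\mathcal B\subset\mathcal D$ be multiplicative subalgebras of $\mathcal R$ having the same images under the projection map $\mathcal R\to\mathcal R/\mathcal I$. Moreover, suppose that $$\{\mathcal B,\ldots,\mathcal B,\mathcal D\cap\mathcal I\}\subset\mathcal I\qquad\text{and}\qquad\{\mathcal B,\ldots,\mathcal B\}\subset\mathcal D .$$ Then $\mathcal B/(\mathcal B\cap\mathcal I)$ inherits a Nambu ring structure whose bracket is determined by the commutativity of the diagram with top arrow $\{,\ldots,\}:\mathcal B\times\cdots\times\mathcal B\to\mathcal D$, vertical arrows the quotient projections $\mathcal B\times\cdots\times\mathcal B\to\frac{\mathcal B}{\mathcal B\cap\mathcal I}\times\cdots\times\frac{\mathcal B}{\mathcal B\cap\mathcal I}$ and $\mathcal D\to\frac{\mathcal D}{\mathcal D\cap\mathcal I}=\frac{\mathcal B}{\mathcal B\cap\mathcal I}$, and bottom arrow the induced bracket; i.e. the induced bracket of the classes of $b_1,\ldots,b_n\in\mathcal B$ is the class of $\{b_1,\ldots,b_n\}\in\mathcal D$ in $\mathcal D/(\mathcal D\cap\mathcal I)=\mathcal B/(\mathcal B\cap\mathcal I)$.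
   Context: A Nambu ring is an associative, commutative ring $\mathcal R$ with a skew-symmetric $n$-multilinear bracket $\{,\ldots,\}:\mathcal R\times\cdots\times\mathcal R\to\mathcal R$ ($n$ copies) satisfying the Leibniz rule $\{f_1,\ldots,f_{n-1},gh\}=g\{f_1,\ldots,f_{n-1},h\}+\{f_1,\ldots,f_{n-1},g\}h$ and the fundamental identity $\{g_1,\ldots,g_{n-1},\{f_1,\ldots,f_n\}\}=\sum_{k=1}^n\{f_1,\ldots,f_{k-1},\{g_1,\ldots,g_{n-1},f_k\},\ldots,f_n\}$. An ideal means an ideal of the underlying commutative ring; a multiplicative subalgebra means a subring with respect to the (associative, commutative) multiplication, not assumed closed under the bracket. Since $\mathcal B\subset\mathcal D$ have the same image in $\mathcal R/\mathcal I$, the inclusion induces the identification $\mathcal B/(\mathcal B\cap\mathcal I)=\mathcal D/(\mathcal D\cap\mathcal I)$. *)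

theory Defs
  imports "HOL-Algebra.Algebra"
begin

text \<open>
  "Associative, commutative ring" is read without assuming a unit, and likewise subrings are not
  required to contain a unit. For rings with unit the notions below agree with those of HOL-Algebra
  (see the lemmas following the definitions). The field \<open>one\<close> of the ring record is never
  referred to.
\<close>

locale comm_rng = abelian_group R for R (structure) +
  assumes m_closed: "\<lbrakk>x \<in> carrier R; y \<in> carrier R\<rbrakk> \<Longrightarrow> x \<otimes> y \<in> carrier R"
    and m_assoc: "\<lbrakk>x \<in> carrier R; y \<in> carrier R; z \<in> carrier R\<rbrakk>
          \<Longrightarrow> (x \<otimes> y) \<otimes> z = x \<otimes> (y \<otimes> z)"
    and m_comm: "\<lbrakk>x \<in> carrier R; y \<in> carrier R\<rbrakk> \<Longrightarrow> x \<otimes> y = y \<otimes> x"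
    and l_distr: "\<lbrakk>x \<in> carrier R; y \<in> carrier R; z \<in> carrier R\<rbrakk>
          \<Longrightarrow> (x \<oplus> y) \<otimes> z = x \<otimes> z \<oplus> y \<otimes> z"

locale rng_ideal = additive_subgroup I R for I and R (structure) +
  assumes I_l_closed: "\<lbrakk>a \<in> I; x \<in> carrier R\<rbrakk> \<Longrightarrow> x \<otimes> a \<in> I"
    and I_r_closed: "\<lbrakk>a \<in> I; x \<in> carrier R\<rbrakk> \<Longrightarrow> a \<otimes> x \<in> I"

locale subrng = additive_subgroup H R for H and R (structure) +
  assumes sub_m_closed: "\<lbrakk>x \<in> H; y \<in> H\<rbrakk> \<Longrightarrow> x \<otimes> y \<in> H"

text \<open>The \<open>n\<close>-fold Cartesian power of \<open>S\<close>.\<close>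

definition tuples :: "nat \<Rightarrow> 'a set \<Rightarrow> 'a list set" where
  "tuples n S = {xs. length xs = n \<and> set xs \<subseteq> S}"

text \<open>
  Multilinearity is additivity in each argument, the only linearity available over a bare ring.
  Skew-symmetry is the sign rule for transpositions; vanishing on repeated arguments, which is
  stronger in the presence of 2-torsion, is not demanded.
\<close>

locale nambu_ring = comm_rng R for n :: nat and R :: "('a, 'b) ring_scheme" (structure)
    and br :: "'a list \<Rightarrow> 'a" +
  assumes arity_pos: "0 < n"
    and bracket_closed: "fs \<in> tuples n (carrier R) \<Longrightarrow> br fs \<in> carrier R"
    and multilinear: "\<lbrakk>fs \<in> tuples n (carrier R); i < n; x \<in> carrier R; y \<in> carrier R\<rbrakk>
          \<Longrightarrow> br (fs[i := x \<oplus> y]) = br (fs[i := x]) \<oplus> br (fs[i := y])"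
    and skew_symmetric: "\<lbrakk>fs \<in> tuples n (carrier R); i < n; j < n; i \<noteq> j\<rbrakk>
          \<Longrightarrow> br (fs[i := fs ! j, j := fs ! i]) = \<ominus> br fs"
    and leibniz: "\<lbrakk>fs \<in> tuples (n - 1) (carrier R); g \<in> carrier R; h \<in> carrier R\<rbrakk>
          \<Longrightarrow> br (fs @ [g \<otimes> h]) = g \<otimes> br (fs @ [h]) \<oplus> br (fs @ [g]) \<otimes> h"
    and fundamental_identity:
          "\<lbrakk>gs \<in> tuples (n - 1) (carrier R); fs \<in> tuples n (carrier R)\<rbrakk>
          \<Longrightarrow> br (gs @ [br fs]) = (\<Oplus>k \<in> {..<n}. br (fs[k := br (gs @ [fs ! k])]))"

text \<open>The ring \<open>S / (S \<inter> I)\<close> for a subring \<open>S\<close> of \<open>R\<close>.\<close>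

abbreviation sub_quot :: "('a, 'b) ring_scheme \<Rightarrow> 'a set \<Rightarrow> 'a set \<Rightarrow> 'a set ring" where
  "sub_quot R S I \<equiv> (R\<lparr>carrier := S\<rparr>) Quot (S \<inter> I)"

text \<open>
  The map \<open>B / (B \<inter> I) \<rightarrow> D / (D \<inter> I)\<close> induced by an inclusion \<open>B \<subseteq> D\<close>: it enlarges a coset of
  \<open>B \<inter> I\<close> to the coset of \<open>D \<inter> I\<close> containing it.
\<close>

definition incl_quot :: "('a, 'b) ring_scheme \<Rightarrow> 'a set \<Rightarrow> 'a set \<Rightarrow> 'a set \<Rightarrow> 'a set" where
  "incl_quot R D I C = (D \<inter> I) <+>\<^bsub>R\<^esub> C"

subsection \<open>Agreement with HOL-Algebra for rings with unit\<close>

lemma cring_imp_comm_rng: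
  assumes "cring R"
  shows "comm_rng R"
proof -
  interpret cring R by fact
  show ?thesis
    by unfold_locales (auto simp: m_assoc l_distr intro: m_comm)
qed

lemma cring_iff_comm_rng_unit:
  "cring R \<longleftrightarrow> comm_rng R \<and> \<one>\<^bsub>R\<^esub> \<in> carrier R \<and> (\<forall>x \<in> carrier R. \<one>\<^bsub>R\<^esub> \<otimes>\<^bsub>R\<^esub> x = x)"
proof
  assume "cring R"
  then interpret cring R .
  show "comm_rng R \<and> \<one>\<^bsub>R\<^esub> \<in> carrier R \<and> (\<forall>x \<in> carrier R. \<one>\<^bsub>R\<^esub> \<otimes>\<^bsub>R\<^esub> x = x)"
    using cring_imp_comm_rng[OF \<open>cring R\<close>] by simp
next
  assume *: "comm_rng R \<and> \<one>\<^bsub>R\<^esub> \<in> carrier R \<and> (\<forall>x \<in> carrier R. \<one>\<^bsub>R\<^esub> \<otimes>\<^bsub>R\<^esub> x = x)"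
  then interpret comm_rng R by blast
  have "comm_monoid R"
    using * by (intro comm_monoidI) (auto intro: m_closed m_assoc m_comm)
  then show "cring R"
    by (intro cringI) (auto intro: abelian_group_axioms l_distr)
qed

lemma rng_ideal_iff_ideal:
  assumes "ring R"
  shows "rng_ideal I R \<longleftrightarrow> ideal I R"
  using assms
  by (auto simp: rng_ideal_def rng_ideal_axioms_def ideal_def ideal_axioms_def
      additive_subgroup_def)

lemma subring_iff_subrng_unit:
  assumes "ring R"
  shows "subring S R \<longleftrightarrow> subrng S R \<and> \<one>\<^bsub>R\<^esub> \<in> S"
  using assms
  by (auto simp: subring_def subrng_def subrng_axioms_def additive_subgroup_def submonoid_def
      subgroup_def)

lemma sub_quot_cring:
  assumes "cring R" "ideal I R" "subring S R"
  shows "cring (sub_quot R S I)"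
proof -
  interpret R: cring R by fact
  interpret I: ideal I R by fact
  have S: "cring (R\<lparr>carrier := S\<rparr>)"
    using R.subcring_iff R.subcringI' assms(3) subringE(1) by blast
  interpret S: cring "R\<lparr>carrier := S\<rparr>" by fact
  have inv: "\<ominus>\<^bsub>R\<lparr>carrier := S\<rparr>\<^esub> x = \<ominus>\<^bsub>R\<^esub> x" if "x \<in> S" for x
  proof (rule S.minus_equality)
    show "\<ominus>\<^bsub>R\<^esub> x \<oplus>\<^bsub>R\<lparr>carrier := S\<rparr>\<^esub> x = \<zero>\<^bsub>R\<lparr>carrier := S\<rparr>\<^esub>"
      using that subringE(1)[OF assms(3)] by (auto intro: R.l_neg)
  qed (use that subringE(5)[OF assms(3)] in auto)
  have "subgroup (S \<inter> I) (add_monoid (R\<lparr>carrier := S\<rparr>))"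
    using inv subringE[OF assms(3)]
    by (intro S.add.subgroupI) (auto simp: a_inv_def[symmetric])
  then have "ideal (S \<inter> I) (R\<lparr>carrier := S\<rparr>)"
    using subringE[OF assms(3)] I.I_l_closed I.I_r_closed
    by (intro idealI S.ring_axioms) auto
  then show ?thesis
    by (rule ideal.quotient_is_cring) (rule S)
qed

subsection \<open>The identification of \<open>B / (B \<inter> I)\<close> with \<open>D / (D \<inter> I)\<close>\<close>

lemma (in comm_rng) incl_quot_coset:
  assumes "rng_ideal I R" "subrng B R" "subrng D R" "B \<subseteq> D" "b \<in> B"
  shows "incl_quot R D I ((B \<inter> I) +> b) = (D \<inter> I) +> b"
proof -
  interpret I: rng_ideal I R by fact
  interpret B: subrng B R by fact
  interpret D: subrng D R by fact
  have b: "b \<in> carrier R" using assms by auto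
  show ?thesis
  proof
    show "incl_quot R D I ((B \<inter> I) +> b) \<subseteq> (D \<inter> I) +> b"
    proof
      fix x assume "x \<in> incl_quot R D I ((B \<inter> I) +> b)"
      then obtain d i where di: "d \<in> D \<inter> I" "i \<in> B \<inter> I" "x = d \<oplus> (i \<oplus> b)"
        by (auto simp: incl_quot_def set_add_def' a_r_coset_def')
      moreover have "x = (d \<oplus> i) \<oplus> b"
        using di b by (simp add: a_assoc)
      moreover have "d \<oplus> i \<in> D \<inter> I"
        using di \<open>B \<subseteq> D\<close> by auto
      ultimately show "x \<in> (D \<inter> I) +> b"
        unfolding a_r_coset_def' by blast
    qed
    show "(D \<inter> I) +> b \<subseteq> incl_quot R D I ((B \<inter> I) +> b)"
    proof
      fix x assume "x \<in> (D \<inter> I) +> b"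
      then obtain d where d: "d \<in> D \<inter> I" "x = d \<oplus> b"
        by (auto simp: a_r_coset_def')
      then have "x = d \<oplus> (\<zero> \<oplus> b)" using b by simp
      then show "x \<in> incl_quot R D I ((B \<inter> I) +> b)"
        using d B.zero_closed I.zero_closed
        unfolding incl_quot_def set_add_def' a_r_coset_def' by blast
    qed
  qed
qed

lemma (in comm_rng) coset_eq_iff:
  assumes "additive_subgroup H R" "x \<in> carrier R" "y \<in> carrier R"
  shows "H +> x = H +> y \<longleftrightarrow> x \<ominus> y \<in> H"
proof -
  interpret H: additive_subgroup H R by fact
  show ?thesis
  proof
    assume "H +> x = H +> y"
    moreover have "x \<in> H +> x"
      using assms H.zero_closed unfolding a_r_coset_def' by force
    ultimately obtain h where "h \<in> H" "x = h \<oplus> y"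
      by (auto simp: a_r_coset_def')
    then show "x \<ominus> y \<in> H"
      using assms by (simp add: minus_eq a_assoc r_neg)
  next
    assume h: "x \<ominus> y \<in> H"
    have "x = (x \<ominus> y) \<oplus> y"
      using assms by (simp add: minus_eq a_assoc l_neg)
    then have "x \<in> H +> y"
      using h unfolding a_r_coset_def' by blast
    then show "H +> x = H +> y"
      using a_repr_independence assms(3) H.a_subgroup by metis
  qed
qed

lemma (in comm_rng) incl_quot_bij:
  assumes "rng_ideal I R" "subrng B R" "subrng D R" "B \<subseteq> D"
    and img: "(\<lambda>x. I +> x) ` B = (\<lambda>x. I +> x) ` D"
  shows "bij_betw (incl_quot R D I) (carrier (sub_quot R B I)) (carrier (sub_quot R D I))"
proof -
  interpret I: rng_ideal I R by fact
  interpret B: subrng B R by fact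
  interpret D: subrng D R by fact
  have inter: "additive_subgroup (S \<inter> I) R" if "subrng S R" for S
  proof -
    interpret S: subrng S R by fact
    show ?thesis
      using add.subgroups_Inter_pair[OF S.a_subgroup I.a_subgroup] by (rule additive_subgroup.intro)
  qed
  have car: "carrier (sub_quot R S I) = (\<lambda>x. (S \<inter> I) +> x) ` S" for S
    by (auto simp: FactRing_def A_RCOSETS_def' a_r_coset_def')
  have minus: "x \<ominus> y \<in> S" if "subrng S R" "x \<in> S" "y \<in> S" for S x y
  proof -
    interpret S: subrng S R by fact
    show ?thesis using that by (simp add: minus_eq)
  qed
  have "inj_on (incl_quot R D I) (carrier (sub_quot R B I))"
  proof (rule inj_onI, unfold car, clarify)
    fix x y assume xy: "x \<in> B" "y \<in> B"
      and "incl_quot R D I ((B \<inter> I) +> x) = incl_quot R D I ((B \<inter> I) +> y)"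
    then have "(D \<inter> I) +> x = (D \<inter> I) +> y"
      using incl_quot_coset assms by metis
    then have "x \<ominus> y \<in> D \<inter> I"
      using coset_eq_iff[OF inter[OF assms(3)]] xy by simp
    then show "(B \<inter> I) +> x = (B \<inter> I) +> y"
      using coset_eq_iff[OF inter[OF assms(2)]] xy minus[OF assms(2)] by simp
  qed
  moreover have "incl_quot R D I ` carrier (sub_quot R B I) = carrier (sub_quot R D I)"
  proof -
    have "\<exists>b \<in> B. (D \<inter> I) +> d = (D \<inter> I) +> b" if d: "d \<in> D" for d
    proof -
      from img d obtain b where b: "b \<in> B" "I +> d = I +> b" by blast
      then have "d \<ominus> b \<in> I"
        using coset_eq_iff[OF I.additive_subgroup_axioms] d by simp
      then show ?thesis
        using coset_eq_iff[OF inter[OF assms(3)]] b d minus[OF assms(3)] \<open>B \<subseteq> D\<close>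
        by (intro bexI[of _ b]) auto
    qed
    then have "(\<lambda>x. (D \<inter> I) +> x) ` B = (\<lambda>x. (D \<inter> I) +> x) ` D"
      using \<open>B \<subseteq> D\<close> by blast
    moreover have "incl_quot R D I ` (\<lambda>x. (B \<inter> I) +> x) ` B = (\<lambda>x. (D \<inter> I) +> x) ` B"
      unfolding image_image using incl_quot_coset[OF assms(1-4)] by (rule image_cong[OF refl])
    ultimately show ?thesis
      unfolding car by simp
  qed
  ultimately show ?thesis by (simp add: bij_betw_def)
qed

end

theory Submission
  imports Defs
begin

text \<open>
  The ring \<open>B / (B \<inter> I)\<close> embeds into \<open>R / I\<close>, so two elements of \<open>B\<close> have the same class as soon as
  they are congruent modulo \<open>I\<close>. The bracket of elements of \<open>B\<close> lies in \<open>D\<close>, and since \<open>B\<close> and \<open>D\<close>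
  have the same image modulo \<open>I\<close>, it is congruent to some \<open>c \<in> B\<close>; the induced bracket must be the
  class of that \<open>c\<close>.

  What has to be shown is that this bracket respects congruence. By skew-symmetry, the hypothesis on
  \<open>{B, \<dots>, B, D \<inter> I}\<close> applies to an argument in any slot (\<open>br_slot_in_I\<close>); by additivity, replacing
  one argument by a congruent element of \<open>D\<close> then does not change the bracket modulo \<open>I\<close>
  (\<open>p_br_slot_cong\<close>). Replacing all arguments one after the other shows that the induced bracket is
  well defined (\<open>p_br_cong\<close>).

  Each axiom for the induced bracket is the corresponding axiom in \<open>R\<close>, read modulo \<open>I\<close>. In
  additivity, skew-symmetry and the Leibniz rule the outer operations are those of the ring, and they
  respect congruence because \<open>I\<close> is an ideal. The fundamental
  identity involves inner brackets, which lie in \<open>D\<close> but perhaps not in \<open>B\<close>, and whose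
  representatives in \<open>B\<close> must be inserted into the outer bracket. This is harmless because the
  replacement of a single argument is allowed for elements of \<open>D\<close>. The nested brackets themselves
  need not lie in \<open>D\<close>, which is why all computations are done in \<open>R / I\<close> and not in \<open>D / (D \<inter> I)\<close>.

  Uniqueness holds because \<open>B / (B \<inter> I) \<rightarrow> D / (D \<inter> I)\<close> is injective and every tuple of classes
  comes from a tuple of elements of \<open>B\<close>.
\<close>

section \<open>Subrings and quotients of rings without unit\<close>

lemma (in comm_rng) subrng_is_comm_rng:
  assumes "subrng H R"
  shows "comm_rng (R\<lparr>carrier := H\<rparr>)"
proof -
  interpret H: subrng H R by fact
  have "abelian_group (R\<lparr>carrier := H\<rparr>)"
  proof (rule abelian_groupI)
    fix x assume "x \<in> carrier (R\<lparr>carrier := H\<rparr>)"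
    then show "\<exists>y \<in> carrier (R\<lparr>carrier := H\<rparr>). y \<oplus>\<^bsub>R\<lparr>carrier := H\<rparr>\<^esub> x = \<zero>\<^bsub>R\<lparr>carrier := H\<rparr>\<^esub>"
      by (intro bexI[of _ "\<ominus> x"]) (auto simp: l_neg)
  qed (auto simp: a_ac)
  then show ?thesis
    by (rule comm_rng.intro, unfold_locales)
       (auto simp: H.sub_m_closed m_assoc l_distr intro: m_comm)
qed

lemma (in comm_rng) rng_ideal_Int_subrng:
  assumes "rng_ideal I R" "subrng H R"
  shows "rng_ideal (H \<inter> I) (R\<lparr>carrier := H\<rparr>)"
proof -
  interpret I: rng_ideal I R by fact
  interpret H: subrng H R by fact
  interpret S: comm_rng "R\<lparr>carrier := H\<rparr>"
    by (rule subrng_is_comm_rng) fact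
  have inv: "\<ominus>\<^bsub>R\<lparr>carrier := H\<rparr>\<^esub> x = \<ominus> x" if "x \<in> H" for x
    by (rule S.minus_equality) (use that in \<open>auto simp: l_neg\<close>)
  have "subgroup (H \<inter> I) (add_monoid (R\<lparr>carrier := H\<rparr>))"
    using inv IntI[OF H.zero_closed I.zero_closed]
    by (intro S.add.subgroupI) (auto simp: a_inv_def[symmetric] simp del: H.zero_closed I.zero_closed)
  then show ?thesis
    by (intro rng_ideal.intro additive_subgroup.intro rng_ideal_axioms.intro)
       (auto intro: H.sub_m_closed I.I_l_closed I.I_r_closed)
qed

context comm_rng
begin

lemma coset_absorb:
  assumes "rng_ideal I R" "i \<in> I" "y \<in> carrier R"
  shows "I +> (i \<oplus> y) = I +> y"
proof -
  interpret I: rng_ideal I R by fact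
  have "i \<oplus> y \<in> I +> y"
    using assms unfolding a_r_coset_def' by blast
  then show ?thesis
    using a_repr_independence[OF _ _ I.a_subgroup] assms by blast
qed

lemma coset_add:
  assumes "rng_ideal I R" "x \<in> carrier R" "y \<in> carrier R"
  shows "(I +> x) \<oplus>\<^bsub>R Quot I\<^esub> (I +> y) = I +> (x \<oplus> y)"
proof -
  interpret I: rng_ideal I R by fact
  interpret abelian_subgroup I R
    by (rule abelian_subgroupI3) unfold_locales
  show ?thesis
    using a_rcos_sum assms by (simp add: FactRing_def)
qed

text \<open>
  The product of two cosets is a union of cosets, one for every choice of representatives; the
  ideal property makes all of them equal.
\<close>

lemma coset_mult:
  assumes "rng_ideal I R" and x: "x \<in> carrier R" and y: "y \<in> carrier R"
  shows "(I +> x) \<otimes>\<^bsub>R Quot I\<^esub> (I +> y) = I +> (x \<otimes> y)"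
proof -
  interpret I: rng_ideal I R by fact
  have r_distr: "a \<otimes> (b \<oplus> c) = a \<otimes> b \<oplus> a \<otimes> c"
    if "a \<in> carrier R" "b \<in> carrier R" "c \<in> carrier R" for a b c
    using that by (simp add: m_comm[of a] l_distr)
  have eq: "I +> ((i \<oplus> x) \<otimes> (j \<oplus> y)) = I +> (x \<otimes> y)" if ij: "i \<in> I" "j \<in> I" for i j
  proof -
    have c: "i \<in> carrier R" "j \<in> carrier R"
      using ij by auto
    have "(i \<oplus> x) \<otimes> (j \<oplus> y) = (i \<otimes> (j \<oplus> y) \<oplus> x \<otimes> j) \<oplus> x \<otimes> y"
      using c x y by (simp add: l_distr r_distr m_closed a_ac)
    moreover have "i \<otimes> (j \<oplus> y) \<oplus> x \<otimes> j \<in> I"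
      using ij c x y by (simp add: I.I_l_closed I.I_r_closed)
    ultimately show ?thesis
      using coset_absorb[OF assms(1)] x y by (simp add: m_closed)
  qed
  have "I +> x \<noteq> {}" "I +> y \<noteq> {}"
    using I.zero_closed unfolding a_r_coset_def' by blast+
  moreover have "rcoset_mult R I (I +> x) (I +> y) = (\<Union>a \<in> I +> x. \<Union>b \<in> I +> y. I +> (x \<otimes> y))"
    unfolding rcoset_mult_def
  proof (intro SUP_cong refl)
    fix a b assume "a \<in> I +> x" "b \<in> I +> y"
    then obtain i j where "i \<in> I" "a = i \<oplus> x" "j \<in> I" "b = j \<oplus> y"
      by (auto simp: a_r_coset_def')
    then show "I +> (a \<otimes> b) = I +> (x \<otimes> y)"
      by (simp add: eq)
  qed
  ultimately show ?thesis
    by (simp add: FactRing_def)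
qed

lemma carrier_Quot: "carrier (R Quot I) = (\<lambda>x. I +> x) ` carrier R"
  by (auto simp: FactRing_def A_RCOSETS_def' a_r_coset_def')

lemma coset_zero:
  assumes "rng_ideal I R"
  shows "I +> \<zero> = \<zero>\<^bsub>R Quot I\<^esub>"
proof -
  interpret I: rng_ideal I R by fact
  show ?thesis
    by (auto simp: FactRing_def a_r_coset_def')
qed

lemma quotient_is_comm_rng:
  assumes I: "rng_ideal I R"
  shows "comm_rng (R Quot I)"
proof -
  note coset = coset_add[OF I] coset_mult[OF I] coset_zero[OF I, symmetric] carrier_Quot
  have "abelian_group (R Quot I)"
  proof (rule abelian_groupI)
    fix U assume "U \<in> carrier (R Quot I)"
    then obtain x where x: "x \<in> carrier R" "U = I +> x"
      by (auto simp: carrier_Quot)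
    then show "\<exists>V \<in> carrier (R Quot I). V \<oplus>\<^bsub>R Quot I\<^esub> U = \<zero>\<^bsub>R Quot I\<^esub>"
      by (intro bexI[of _ "I +> (\<ominus> x)"]) (auto simp: coset l_neg)
  qed (auto simp: coset a_ac)
  then show ?thesis
  proof (rule comm_rng.intro, unfold_locales)
    fix U V assume "U \<in> carrier (R Quot I)" "V \<in> carrier (R Quot I)"
    then obtain u v where "u \<in> carrier R" "U = I +> u" "v \<in> carrier R" "V = I +> v"
      by (auto simp: carrier_Quot)
    then show "U \<otimes>\<^bsub>R Quot I\<^esub> V = V \<otimes>\<^bsub>R Quot I\<^esub> U"
      using m_comm[of u v] by (simp add: coset)
  qed (auto simp: coset m_closed m_assoc l_distr)
qed

lemma coset_abelian_group_hom:
  assumes I: "rng_ideal I R"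
  shows "abelian_group_hom R (R Quot I) (\<lambda>x. I +> x)"
proof -
  interpret Q: comm_rng "R Quot I"
    by (rule quotient_is_comm_rng) fact
  show ?thesis
    by (intro abelian_group_homI abelian_group_axioms Q.abelian_group_axioms
          group_hom.intro group_hom_axioms.intro a_group Q.a_group homI)
       (auto simp: coset_add[OF I] carrier_Quot)
qed

end

section \<open>Sums and tuples under maps\<close>

lemma (in abelian_group_hom) hom_finsum:
  assumes "\<And>k. k \<in> A \<Longrightarrow> f k \<in> carrier G"
  shows "h (\<Oplus>\<^bsub>G\<^esub>k \<in> A. f k) = (\<Oplus>\<^bsub>H\<^esub>k \<in> A. h (f k))"
  using assms by (induction A rule: infinite_finite_induct) (auto simp: Pi_def)

lemma tuples_iff: "xs \<in> tuples n S \<longleftrightarrow> length xs = n \<and> (\<forall>i<n. xs ! i \<in> S)"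
  by (auto simp: tuples_def in_set_conv_nth subset_iff)

lemma tuples_update: "xs \<in> tuples n S \<Longrightarrow> x \<in> S \<Longrightarrow> xs[i := x] \<in> tuples n S"
  by (auto simp: tuples_def dest: set_update_subset_insert[THEN subsetD])

lemma tuples_snoc:
  assumes "xs \<in> tuples (n - 1) S" "x \<in> S" "0 < n"
  shows "xs @ [x] \<in> tuples n S"
  using assms by (auto simp: tuples_def)

lemma tuples_image:
  "Xs \<in> tuples n (f ` S) \<longleftrightarrow> (\<exists>xs \<in> tuples n S. Xs = map f xs)"
proof
  assume "Xs \<in> tuples n (f ` S)"
  then have "Xs \<in> map f ` lists S" and "length Xs = n"
    by (auto simp: tuples_def lists_image[symmetric] in_lists_conv_set)
  then show "\<exists>xs \<in> tuples n S. Xs = map f xs"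
    by (auto simp: tuples_def lists_eq_set)
qed (force simp: tuples_def)

section \<open>The bracket modulo the ideal\<close>

locale nambu_reduction = nambu_ring n R br
  for n :: nat and R :: "('a, 'm) ring_scheme" (structure) and br +
  fixes I B D :: "'a set"
  assumes I: "rng_ideal I R"
    and B: "subrng B R" and D: "subrng D R" and B_subset_D: "B \<subseteq> D"
    and same_image: "(\<lambda>x. I +> x) ` B = (\<lambda>x. I +> x) ` D"
    and br_last_in_I: "\<lbrakk>bs \<in> tuples (n - 1) B; d \<in> D \<inter> I\<rbrakk> \<Longrightarrow> br (bs @ [d]) \<in> I"
    and br_in_D: "bs \<in> tuples n B \<Longrightarrow> br bs \<in> D"
begin

sublocale I: rng_ideal I R by (rule I)
sublocale B: subrng B R by (rule B)
sublocale D: subrng D R by (rule D)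

text \<open>
  Congruence modulo \<open>I\<close> is written as an equation \<open>p x = p y\<close> in \<open>R / I\<close>, so that it can be
  computed with by means of the ring operations of the quotient.
\<close>

abbreviation p :: "'a \<Rightarrow> 'a set" where "p x \<equiv> I +> x"
abbreviation \<pi> :: "'a \<Rightarrow> 'a set" where "\<pi> x \<equiv> (B \<inter> I) +> x"
abbreviation S :: "('a, 'm) ring_scheme" where "S \<equiv> R\<lparr>carrier := B\<rparr>"
abbreviation Q :: "'a set ring" where "Q \<equiv> sub_quot R B I"

lemma B_carrier [simp]: "x \<in> B \<Longrightarrow> x \<in> carrier R"
  by auto

lemma D_carrier [simp]: "x \<in> D \<Longrightarrow> x \<in> carrier R"
  by auto

lemma B_D: "x \<in> B \<Longrightarrow> x \<in> D"
  using B_subset_D by auto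

lemma tuples_B_carrier: "bs \<in> tuples n B \<Longrightarrow> bs \<in> tuples n (carrier R)"
  and tuples_B_carrier': "bs \<in> tuples (n - 1) B \<Longrightarrow> bs \<in> tuples (n - 1) (carrier R)"
  by (auto simp: tuples_iff)

lemma p_eq_iff: "x \<in> carrier R \<Longrightarrow> y \<in> carrier R \<Longrightarrow> p x = p y \<longleftrightarrow> x \<ominus> y \<in> I"
  by (rule coset_eq_iff) unfold_locales

sublocale S: comm_rng S
  by (rule subrng_is_comm_rng) unfold_locales

sublocale J: rng_ideal "B \<inter> I" S
  by (rule rng_ideal_Int_subrng) unfold_locales

sublocale Q: comm_rng Q
  by (rule S.quotient_is_comm_rng) unfold_locales

sublocale P: comm_rng "R Quot I"
  by (rule quotient_is_comm_rng) unfold_locales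

lemma coset_S: "a_r_coset S H x = H +> x"
  by (simp add: a_r_coset_def')

text \<open>
  This is the injectivity of \<open>B / (B \<inter> I) \<rightarrow> R / I\<close>: a difference of elements of \<open>B\<close> is in \<open>B\<close>
  anyway.
\<close>

lemma \<pi>_eq_iff:
  assumes "x \<in> B" "y \<in> B"
  shows "\<pi> x = \<pi> y \<longleftrightarrow> p x = p y"
proof -
  have "additive_subgroup (B \<inter> I) R"
    using add.subgroups_Inter_pair[OF B.a_subgroup I.a_subgroup] by (rule additive_subgroup.intro)
  then show ?thesis
    using assms by (simp add: coset_eq_iff p_eq_iff) (simp add: minus_eq)
qed

lemma carrier_Q: "carrier Q = \<pi> ` B"
  using S.carrier_Quot[of "B \<inter> I"] by (simp add: coset_S)

lemma \<pi>_add: "x \<in> B \<Longrightarrow> y \<in> B \<Longrightarrow> \<pi> x \<oplus>\<^bsub>Q\<^esub> \<pi> y = \<pi> (x \<oplus> y)"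
  using S.coset_add[OF J.rng_ideal_axioms] by (simp add: coset_S)

lemma \<pi>_mult: "x \<in> B \<Longrightarrow> y \<in> B \<Longrightarrow> \<pi> x \<otimes>\<^bsub>Q\<^esub> \<pi> y = \<pi> (x \<otimes> y)"
  using S.coset_mult[OF J.rng_ideal_axioms] by (simp add: coset_S)

lemma \<pi>_minus: "x \<in> B \<Longrightarrow> \<ominus>\<^bsub>Q\<^esub> \<pi> x = \<pi> (\<ominus> x)"
  using S.coset_zero[OF J.rng_ideal_axioms]
  by (intro Q.minus_equality) (auto simp: \<pi>_add carrier_Q coset_S l_neg)

lemma \<pi>_finsum:
  assumes "\<And>k. k \<in> A \<Longrightarrow> f k \<in> B"
  shows "(\<Oplus>\<^bsub>Q\<^esub>k \<in> A. \<pi> (f k)) = \<pi> (\<Oplus>\<^bsub>S\<^esub>k \<in> A. f k)"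
proof -
  interpret h: abelian_group_hom S Q \<pi>
    using S.coset_abelian_group_hom[OF J.rng_ideal_axioms] by (simp add: coset_S)
  show ?thesis
    using h.hom_finsum[of A f] assms by simp
qed

lemma p_hom_S: "abelian_group_hom S (R Quot I) p"
  by (intro abelian_group_homI S.abelian_group_axioms P.abelian_group_axioms
        group_hom.intro group_hom_axioms.intro S.a_group P.a_group homI)
     (auto simp: coset_add[OF I] carrier_Quot)

text \<open>
  The two sums are formed in different rings, over elements of \<open>B\<close> on the left and of \<open>R\<close> on the
  right. They are compared in \<open>R / I\<close>, to which both rings map additively.
\<close>

lemma p_finsum_cong:
  assumes "\<And>k. k \<in> A \<Longrightarrow> f k \<in> B" "\<And>k. k \<in> A \<Longrightarrow> g k \<in> carrier R"
    and "\<And>k. k \<in> A \<Longrightarrow> p (f k) = p (g k)"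
  shows "p (\<Oplus>\<^bsub>S\<^esub>k \<in> A. f k) = p (\<Oplus>k \<in> A. g k)"
proof -
  interpret hS: abelian_group_hom S "R Quot I" p
    by (rule p_hom_S)
  interpret hR: abelian_group_hom R "R Quot I" p
    by (rule coset_abelian_group_hom[OF I])
  have "p (\<Oplus>\<^bsub>S\<^esub>k \<in> A. f k) = (\<Oplus>\<^bsub>R Quot I\<^esub>k \<in> A. p (f k))"
    using hS.hom_finsum[of A f] assms by simp
  also have "\<dots> = (\<Oplus>\<^bsub>R Quot I\<^esub>k \<in> A. p (g k))"
    using assms by (intro P.finsum_cong') (auto simp: carrier_Quot)
  also have "\<dots> = p (\<Oplus>k \<in> A. g k)"
    using hR.hom_finsum[of A g] assms by simp
  finally show ?thesis .
qed

lemma B_representative: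
  assumes "d \<in> D"
  obtains b where "b \<in> B" "p d = p b"
  using assms same_image by blast

text \<open>
  A transposition moves an argument from \<open>D \<inter> I\<close> into the last slot at the price of a sign, and
  \<open>I\<close> is closed under negation.
\<close>

lemma br_slot_in_I:
  assumes bs: "bs \<in> tuples n B" and i: "i < n" and d: "d \<in> D \<inter> I"
  shows "br (bs[i := d]) \<in> I"
proof -
  have last: "br (cs[n - 1 := d]) \<in> I" if cs: "cs \<in> tuples n B" for cs
  proof -
    have "cs[n - 1 := d] = take (n - 1) cs @ [d]"
      using cs arity_pos by (intro nth_equalityI) (auto simp: tuples_def nth_append nth_list_update)
    moreover have "take (n - 1) cs \<in> tuples (n - 1) B"
      using cs by (auto simp: tuples_def dest: in_set_takeD)
    ultimately show ?thesis
      using br_last_in_I d by simp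
  qed
  show ?thesis
  proof (cases "i = n - 1")
    case True
    then show ?thesis using last bs by simp
  next
    case False
    let ?fs = "bs[i := d]"
    have fs: "?fs \<in> tuples n (carrier R)"
      using bs d by (intro tuples_update tuples_B_carrier) auto
    have "?fs[i := ?fs ! (n - 1), n - 1 := ?fs ! i] = bs[i := bs ! (n - 1), n - 1 := d]"
      using False bs i by (simp add: tuples_def)
    then have "\<ominus> br ?fs = br (bs[i := bs ! (n - 1), n - 1 := d])"
      using skew_symmetric[OF fs i, of "n - 1"] False arity_pos by simp
    also have "\<dots> \<in> I"
      using bs i by (intro last tuples_update) (auto simp: tuples_iff)
    finally have "\<ominus> (\<ominus> br ?fs) \<in> I"
      by (rule I.a_inv_closed)
    then show ?thesis
      using bracket_closed[OF fs] by simp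
  qed
qed

text \<open>
  The difference \<open>x \<ominus> y\<close> lies in \<open>D \<inter> I\<close>, so by additivity the two brackets differ by an element
  of \<open>I\<close>. Admitting arguments from \<open>D\<close>, and not only from \<open>B\<close>, makes this applicable to an argument
  that is itself a bracket.
\<close>

lemma p_br_slot_cong:
  assumes bs: "bs \<in> tuples n B" and i: "i < n" and x: "x \<in> D" and y: "y \<in> D"
    and eq: "p x = p y"
  shows "p (br (bs[i := x])) = p (br (bs[i := y]))"
proof -
  have bs': "bs \<in> tuples n (carrier R)"
    using bs by (rule tuples_B_carrier)
  have d: "x \<ominus> y \<in> D \<inter> I"
    using eq x y p_eq_iff by (simp add: minus_eq)
  have "x = (x \<ominus> y) \<oplus> y"
    using x y by (simp add: minus_eq a_assoc l_neg)
  then have "br (bs[i := x]) = br (bs[i := x \<ominus> y]) \<oplus> br (bs[i := y])"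
    using multilinear[OF bs' i, of "x \<ominus> y" y] x y by simp
  moreover have "br (bs[i := x \<ominus> y]) \<in> I"
    by (rule br_slot_in_I[OF bs i d])
  moreover have "br (bs[i := y]) \<in> carrier R"
    using bs' y by (intro bracket_closed tuples_update) auto
  ultimately show ?thesis
    using coset_absorb[OF I] by simp
qed

text \<open>
  One argument is exchanged at a time, passing from \<open>bs\<close> to \<open>cs\<close> through the tuples that start like
  \<open>cs\<close> and end like \<open>bs\<close>.
\<close>

lemma p_br_cong:
  assumes bs: "bs \<in> tuples n B" and cs: "cs \<in> tuples n B"
    and eq: "\<And>i. i < n \<Longrightarrow> p (bs ! i) = p (cs ! i)"
  shows "p (br bs) = p (br cs)"
proof -
  define mix where "mix k = take k cs @ drop k bs" for k
  have len: "length bs = n" "length cs = n"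
    using bs cs by (auto simp: tuples_def)
  have mix: "mix k \<in> tuples n B" for k
    using bs cs by (auto simp: mix_def tuples_def dest: in_set_takeD in_set_dropD)
  have "p (br (mix k)) = p (br bs)" if "k \<le> n" for k
    using that
  proof (induction k)
    case 0
    then show ?case by (simp add: mix_def)
  next
    case (Suc k)
    have "mix k = (mix k)[k := bs ! k]" "mix (Suc k) = (mix k)[k := cs ! k]"
      using Suc.prems len
      by (auto simp: mix_def nth_append nth_list_update intro!: nth_equalityI)
    moreover have "p (br ((mix k)[k := bs ! k])) = p (br ((mix k)[k := cs ! k]))"
      using Suc.prems bs cs
      by (intro p_br_slot_cong mix eq B_D) (auto simp: tuples_iff)
    ultimately show ?case
      using Suc by simp
  qed
  from this[of n] show ?thesis
    using len by (simp add: mix_def)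
qed

section \<open>The induced bracket\<close>

text \<open>
  The inverse of the identification \<open>B / (B \<inter> I) = D / (D \<inter> I)\<close> is replaced by the choice of an
  element \<open>c\<close> of \<open>B\<close> that is congruent to a bracket of representatives.
\<close>

definition qbr :: "'a set list \<Rightarrow> 'a set" where
  "qbr = (\<lambda>Cs \<in> tuples n (carrier Q).
     \<pi> (SOME c. c \<in> B \<and> (\<exists>bs \<in> tuples n B. Cs = map \<pi> bs \<and> p (br bs) = p c)))"

lemma tuples_Q: "Cs \<in> tuples m (carrier Q) \<longleftrightarrow> (\<exists>bs \<in> tuples m B. Cs = map \<pi> bs)"
  by (simp add: carrier_Q tuples_image)

text \<open>
  The induced bracket does not depend on the choices: different representatives of the arguments have
  congruent brackets, and congruent elements of \<open>B\<close> have the same class.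
\<close>

lemma qbr_eq:
  assumes bs: "bs \<in> tuples n B" and c: "c \<in> B" and eq: "p (br bs) = p c"
  shows "qbr (map \<pi> bs) = \<pi> c"
proof -
  let ?P = "\<lambda>c. c \<in> B \<and> (\<exists>cs \<in> tuples n B. map \<pi> bs = map \<pi> cs \<and> p (br cs) = p c)"
  have "?P (SOME c. ?P c)"
    using assms by (intro someI[of ?P c]) auto
  then obtain cs where c': "(SOME c. ?P c) \<in> B" and cs: "cs \<in> tuples n B"
    and m: "map \<pi> bs = map \<pi> cs" and eq': "p (br cs) = p (SOME c. ?P c)"
    by auto
  have "p (bs ! i) = p (cs ! i)" if "i < n" for i
    using arg_cong[OF m, of "\<lambda>xs. xs ! i"] that bs cs
    by (auto simp: tuples_iff \<pi>_eq_iff)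
  then have "p (br bs) = p (br cs)"
    by (rule p_br_cong[OF bs cs])
  then have "\<pi> (SOME c. ?P c) = \<pi> c"
    using eq eq' c c' by (simp add: \<pi>_eq_iff)
  then show ?thesis
    using bs by (auto simp: qbr_def tuples_Q)
qed

lemma qbr_obtain:
  assumes "bs \<in> tuples n B"
  obtains c where "c \<in> B" "p (br bs) = p c" "qbr (map \<pi> bs) = \<pi> c"
  using B_representative[OF br_in_D[OF assms]] qbr_eq[OF assms] by metis

text \<open>
  Let \<open>a\<close> and \<open>b k\<close> in \<open>B\<close> represent the inner brackets \<open>{f\<^sub>1, \<dots>, f\<^sub>n}\<close> and
  \<open>{g\<^sub>1, \<dots>, f\<^sub>k}\<close>. Modulo \<open>I\<close>, inserting these representatives into the outer brackets gives the same
  values as inserting the inner brackets, so both sides reduce to those of the identity in \<open>R\<close>.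
\<close>

lemma qbr_fundamental_identity:
  assumes gs: "gs \<in> tuples (n - 1) B" and fs: "fs \<in> tuples n B"
  shows "qbr (map \<pi> gs @ [qbr (map \<pi> fs)])
    = (\<Oplus>\<^bsub>Q\<^esub>k \<in> {..<n}. qbr ((map \<pi> fs)[k := qbr (map \<pi> gs @ [map \<pi> fs ! k])]))"
proof -
  have gfs: "gs @ [fs ! k] \<in> tuples n B" if "k < n" for k
    using gs fs that by (intro tuples_snoc) (auto simp: tuples_iff)
  have "\<exists>b. b \<in> B \<and> p (br (gs @ [fs ! k])) = p b \<and> qbr (map \<pi> gs @ [map \<pi> fs ! k]) = \<pi> b"
    if k: "k < n" for k
  proof -
    have "map \<pi> (gs @ [fs ! k]) = map \<pi> gs @ [map \<pi> fs ! k]"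
      using k fs by (simp add: tuples_iff)
    then show ?thesis
      using qbr_obtain[OF gfs[OF k]] by metis
  qed
  then obtain b where b: "\<And>k. k < n \<Longrightarrow> b k \<in> B"
    "\<And>k. k < n \<Longrightarrow> p (br (gs @ [fs ! k])) = p (b k)"
    "\<And>k. k < n \<Longrightarrow> qbr (map \<pi> gs @ [map \<pi> fs ! k]) = \<pi> (b k)"
    by metis
  have "\<exists>c. c \<in> B \<and> p (br (fs[k := b k])) = p c \<and> qbr ((map \<pi> fs)[k := \<pi> (b k)]) = \<pi> c"
    if k: "k < n" for k
    using qbr_obtain[OF tuples_update[OF fs b(1)[OF k]], of k] unfolding map_update by metis
  then obtain c where c: "\<And>k. k < n \<Longrightarrow> c k \<in> B"
    "\<And>k. k < n \<Longrightarrow> p (br (fs[k := b k])) = p (c k)"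
    "\<And>k. k < n \<Longrightarrow> qbr ((map \<pi> fs)[k := \<pi> (b k)]) = \<pi> (c k)"
    by metis
  obtain a where a: "a \<in> B" "p (br fs) = p a" "qbr (map \<pi> fs) = \<pi> a"
    by (rule qbr_obtain[OF fs])
  have ga: "gs @ [a] \<in> tuples n B"
    using gs a arity_pos by (intro tuples_snoc)
  have sum_B: "(\<Oplus>\<^bsub>S\<^esub>k \<in> {..<n}. c k) \<in> B"
    using S.finsum_closed[of c "{..<n}"] c(1) by auto
  have c_cong: "p (c k) = p (br (fs[k := br (gs @ [fs ! k])]))" if k: "k < n" for k
    using p_br_slot_cong[OF fs k br_in_D[OF gfs[OF k]] B_D[OF b(1)[OF k]] b(2)[OF k]]
      c(2)[OF k] by simp
  \<comment> \<open>The inner bracket is in the last slot, and lies in \<open>D\<close>.\<close>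
  have "p (br (gs @ [a])) = p (br (gs @ [br fs]))"
  proof -
    \<comment> \<open>Slots are counted from 0, so the last one has index \<open>n - 1\<close>.\<close>
    have up: "(gs @ [a])[n - 1 := z] = gs @ [z]" for z
      using gs by (simp add: tuples_def list_update_append)
    have "p (br ((gs @ [a])[n - 1 := a])) = p (br ((gs @ [a])[n - 1 := br fs]))"
      using a arity_pos fs by (intro p_br_slot_cong ga B_D br_in_D) auto
    then show ?thesis
      unfolding up .
  qed
  also have "br (gs @ [br fs]) = (\<Oplus>k \<in> {..<n}. br (fs[k := br (gs @ [fs ! k])]))"
    using gs fs by (intro fundamental_identity tuples_B_carrier tuples_B_carrier')
  also have "p \<dots> = p (\<Oplus>\<^bsub>S\<^esub>k \<in> {..<n}. c k)"
    using c_cong c(1) gfs fs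
    by (intro p_finsum_cong[symmetric] bracket_closed tuples_update tuples_B_carrier
          D_carrier br_in_D) auto
  finally have "qbr (map \<pi> (gs @ [a])) = \<pi> (\<Oplus>\<^bsub>S\<^esub>k \<in> {..<n}. c k)"
    by (rule qbr_eq[OF ga sum_B])
  also have "\<dots> = (\<Oplus>\<^bsub>Q\<^esub>k \<in> {..<n}. \<pi> (c k))"
    using c(1) by (intro \<pi>_finsum[symmetric]) auto
  also have "\<dots> = (\<Oplus>\<^bsub>Q\<^esub>k \<in> {..<n}. qbr ((map \<pi> fs)[k := qbr (map \<pi> gs @ [map \<pi> fs ! k])]))"
    using b c by (intro Q.finsum_cong') (auto simp: carrier_Q simp del: nth_map)
  finally show ?thesis
    using a by simp
qed

text \<open>
  The brackets on the right-hand side are factors of products, and since \<open>I\<close> is an ideal, such a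
  factor can be replaced by a congruent element of \<open>B\<close> without changing the product in \<open>R / I\<close>.
\<close>

lemma qbr_leibniz:
  assumes fs: "fs \<in> tuples (n - 1) B" and g: "g \<in> B" and h: "h \<in> B"
  shows "qbr (map \<pi> fs @ [\<pi> g \<otimes>\<^bsub>Q\<^esub> \<pi> h])
    = \<pi> g \<otimes>\<^bsub>Q\<^esub> qbr (map \<pi> fs @ [\<pi> h]) \<oplus>\<^bsub>Q\<^esub> qbr (map \<pi> fs @ [\<pi> g]) \<otimes>\<^bsub>Q\<^esub> \<pi> h"
proof -
  have t: "fs @ [x] \<in> tuples n B" if "x \<in> B" for x
    using fs that arity_pos by (rule tuples_snoc)
  obtain b where b: "b \<in> B" "p (br (fs @ [h])) = p b" "qbr (map \<pi> (fs @ [h])) = \<pi> b"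
    by (rule qbr_obtain[OF t[OF h]])
  obtain c where c: "c \<in> B" "p (br (fs @ [g])) = p c" "qbr (map \<pi> (fs @ [g])) = \<pi> c"
    by (rule qbr_obtain[OF t[OF g]])
  have gh: "g \<otimes> h \<in> B" and gb: "g \<otimes> b \<in> B" and ch: "c \<otimes> h \<in> B"
    using g h b c by (auto intro: B.sub_m_closed)
  have car: "br (fs @ [x]) \<in> carrier R" if "x \<in> B" for x
    using that by (intro bracket_closed tuples_B_carrier t)
  have "p (br (fs @ [g \<otimes> h])) = p (g \<otimes> br (fs @ [h]) \<oplus> br (fs @ [g]) \<otimes> h)"
    using leibniz[OF tuples_B_carrier'[OF fs]] g h by simp
  also have "\<dots> = p g \<otimes>\<^bsub>R Quot I\<^esub> p (br (fs @ [h])) \<oplus>\<^bsub>R Quot I\<^esub> p (br (fs @ [g])) \<otimes>\<^bsub>R Quot I\<^esub> p h"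
    using g h car by (simp add: coset_mult[OF I] coset_add[OF I] m_closed)
  also have "\<dots> = p (g \<otimes> b \<oplus> c \<otimes> h)"
    using b c g h by (simp add: coset_mult[OF I] coset_add[OF I] m_closed)
  finally have "qbr (map \<pi> (fs @ [g \<otimes> h])) = \<pi> (g \<otimes> b \<oplus> c \<otimes> h)"
    using gb ch by (intro qbr_eq t gh) auto
  then show ?thesis
    using b c g h gb ch by (simp add: \<pi>_mult \<pi>_add)
qed

lemma qbr_add:
  assumes bs: "bs \<in> tuples n B" and i: "i < n" and x: "x \<in> B" and y: "y \<in> B"
  shows "qbr ((map \<pi> bs)[i := \<pi> x \<oplus>\<^bsub>Q\<^esub> \<pi> y])
    = qbr ((map \<pi> bs)[i := \<pi> x]) \<oplus>\<^bsub>Q\<^esub> qbr ((map \<pi> bs)[i := \<pi> y])"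
proof -
  have t: "bs[i := z] \<in> tuples n B" if "z \<in> B" for z
    using bs that by (rule tuples_update)
  obtain b where b: "b \<in> B" "p (br (bs[i := x])) = p b" "qbr (map \<pi> (bs[i := x])) = \<pi> b"
    by (rule qbr_obtain[OF t[OF x]])
  obtain c where c: "c \<in> B" "p (br (bs[i := y])) = p c" "qbr (map \<pi> (bs[i := y])) = \<pi> c"
    by (rule qbr_obtain[OF t[OF y]])
  have car: "br (bs[i := z]) \<in> carrier R" if "z \<in> B" for z
    using that by (intro bracket_closed tuples_B_carrier t)
  have "p (br (bs[i := x \<oplus> y])) = p (br (bs[i := x]) \<oplus> br (bs[i := y]))"
    using multilinear[OF tuples_B_carrier[OF bs] i] x y by simp
  also have "\<dots> = p (br (bs[i := x])) \<oplus>\<^bsub>R Quot I\<^esub> p (br (bs[i := y]))"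
    using x y car by (simp add: coset_add[OF I])
  also have "\<dots> = p (b \<oplus> c)"
    using b c by (simp add: coset_add[OF I])
  finally have "qbr (map \<pi> (bs[i := x \<oplus> y])) = \<pi> (b \<oplus> c)"
    using b c x y by (intro qbr_eq t) auto
  then show ?thesis
    using b c x y by (simp add: \<pi>_add map_update)
qed

lemma qbr_skew:
  assumes bs: "bs \<in> tuples n B" and ij: "i < n" "j < n" "i \<noteq> j"
  shows "qbr ((map \<pi> bs)[i := map \<pi> bs ! j, j := map \<pi> bs ! i]) = \<ominus>\<^bsub>Q\<^esub> qbr (map \<pi> bs)"
proof -
  interpret h: abelian_group_hom R "R Quot I" p
    by (rule coset_abelian_group_hom[OF I])
  let ?cs = "bs[i := bs ! j, j := bs ! i]"
  obtain c where c: "c \<in> B" "p (br bs) = p c" "qbr (map \<pi> bs) = \<pi> c"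
    by (rule qbr_obtain[OF bs])
  have "?cs \<in> tuples n B"
    using bs ij by (intro tuples_update) (auto simp: tuples_iff)
  moreover have "p (br ?cs) = p (\<ominus> c)"
    using skew_symmetric[OF tuples_B_carrier[OF bs] ij] c
      bracket_closed[OF tuples_B_carrier[OF bs]] by simp
  ultimately have "qbr (map \<pi> ?cs) = \<pi> (\<ominus> c)"
    using c by (intro qbr_eq) auto
  then show ?thesis
    using c bs ij by (simp add: map_update \<pi>_minus tuples_def)
qed

lemma nambu_ring_qbr: "nambu_ring n Q qbr"
proof (intro nambu_ring.intro nambu_ring_axioms.intro Q.comm_rng_axioms arity_pos)
  fix fs assume "fs \<in> tuples n (carrier Q)"
  then obtain bs where "bs \<in> tuples n B" "fs = map \<pi> bs"
    by (auto simp: tuples_Q)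
  then show "qbr fs \<in> carrier Q"
    by (metis qbr_obtain carrier_Q imageI)
next
  fix fs i x y
  assume "fs \<in> tuples n (carrier Q)" "i < n" "x \<in> carrier Q" "y \<in> carrier Q"
  then show "qbr (fs[i := x \<oplus>\<^bsub>Q\<^esub> y]) = qbr (fs[i := x]) \<oplus>\<^bsub>Q\<^esub> qbr (fs[i := y])"
    by (auto simp only: tuples_Q carrier_Q[THEN eqset_imp_iff] image_iff qbr_add)
next
  fix fs i j assume "fs \<in> tuples n (carrier Q)" "i < n" "j < n" "i \<noteq> j"
  then show "qbr (fs[i := fs ! j, j := fs ! i]) = \<ominus>\<^bsub>Q\<^esub> qbr fs"
    using qbr_skew unfolding tuples_Q by blast
next
  fix fs g h assume "fs \<in> tuples (n - 1) (carrier Q)" "g \<in> carrier Q" "h \<in> carrier Q"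
  then show "qbr (fs @ [g \<otimes>\<^bsub>Q\<^esub> h])
      = g \<otimes>\<^bsub>Q\<^esub> qbr (fs @ [h]) \<oplus>\<^bsub>Q\<^esub> qbr (fs @ [g]) \<otimes>\<^bsub>Q\<^esub> h"
    by (auto simp only: tuples_Q carrier_Q[THEN eqset_imp_iff] image_iff qbr_leibniz)
next
  fix gs fs assume "gs \<in> tuples (n - 1) (carrier Q)" "fs \<in> tuples n (carrier Q)"
  then show "qbr (gs @ [qbr fs]) = (\<Oplus>\<^bsub>Q\<^esub>k \<in> {..<n}. qbr (fs[k := qbr (gs @ [fs ! k])]))"
    using qbr_fundamental_identity unfolding tuples_Q by blast
qed

lemma qbr_funcset: "qbr \<in> tuples n (carrier Q) \<rightarrow>\<^sub>E carrier Q"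
  using nambu_ring.bracket_closed[OF nambu_ring_qbr] by (auto simp: qbr_def)

text \<open>
  The representative \<open>c \<in> B\<close> of a bracket and the bracket itself both lie in \<open>D\<close>, so their
  congruence modulo \<open>I\<close> is a congruence modulo \<open>D \<inter> I\<close>.
\<close>

lemma incl_quot_qbr:
  assumes bs: "bs \<in> tuples n B"
  shows "incl_quot R D I (qbr (map \<pi> bs)) = (D \<inter> I) +> br bs"
proof -
  obtain c where c: "c \<in> B" "p (br bs) = p c" "qbr (map \<pi> bs) = \<pi> c"
    by (rule qbr_obtain[OF bs])
  have "additive_subgroup (D \<inter> I) R"
    using add.subgroups_Inter_pair[OF D.a_subgroup I.a_subgroup] by (rule additive_subgroup.intro)
  moreover have "c \<ominus> br bs \<in> D \<inter> I"
    using c br_in_D[OF bs] p_eq_iff[of c "br bs"] B_D[of c] by (simp add: minus_eq)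
  ultimately have "(D \<inter> I) +> c = (D \<inter> I) +> br bs"
    using c br_in_D[OF bs] by (simp add: coset_eq_iff)
  then show ?thesis
    using c incl_quot_coset[OF I B D B_subset_D] by simp
qed

lemma qbr_unique:
  assumes f: "f \<in> tuples n (carrier Q) \<rightarrow>\<^sub>E carrier Q"
    and diagram: "\<And>bs. bs \<in> tuples n B \<Longrightarrow> incl_quot R D I (f (map \<pi> bs)) = (D \<inter> I) +> br bs"
  shows "f = qbr"
proof (rule PiE_ext[OF f qbr_funcset])
  fix Cs assume Cs: "Cs \<in> tuples n (carrier Q)"
  then have "incl_quot R D I (f Cs) = incl_quot R D I (qbr Cs)"
    using diagram incl_quot_qbr by (auto simp: tuples_Q)
  moreover have "f Cs \<in> carrier Q" "qbr Cs \<in> carrier Q"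
    using Cs f qbr_funcset by auto
  ultimately show "f Cs = qbr Cs"
    using incl_quot_bij[OF I B D B_subset_D same_image]
    by (meson bij_betw_imp_inj_on inj_onD)
qed

end

theorem theorem4p9:
  fixes n :: nat and R :: "('a, 'm) ring_scheme" (structure)
    and br :: "'a list \<Rightarrow> 'a" and I B D :: "'a set"
  assumes "nambu_ring n R br"
    and "rng_ideal I R"
    and "subrng B R" and "subrng D R" and "B \<subseteq> D"
    and "(\<lambda>x. I +> x) ` B = (\<lambda>x. I +> x) ` D"
    and "\<forall>bs \<in> tuples (n - 1) B. \<forall>d \<in> D \<inter> I. br (bs @ [d]) \<in> I"
    and "\<forall>bs \<in> tuples n B. br bs \<in> D"
  shows "\<exists>qbr \<in> tuples n (carrier (sub_quot R B I)) \<rightarrow>\<^sub>E carrier (sub_quot R B I).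
    nambu_ring n (sub_quot R B I) qbr \<and>
    (\<forall>bs \<in> tuples n B.
        incl_quot R D I (qbr (map (\<lambda>b. (B \<inter> I) +> b) bs)) = (D \<inter> I) +> br bs) \<and>
    (\<forall>qbr' \<in> tuples n (carrier (sub_quot R B I)) \<rightarrow>\<^sub>E carrier (sub_quot R B I).
        (\<forall>bs \<in> tuples n B.
          incl_quot R D I (qbr' (map (\<lambda>b. (B \<inter> I) +> b) bs)) = (D \<inter> I) +> br bs)
        \<longrightarrow> qbr' = qbr)"
proof -
  interpret nambu_reduction n R br I B D
    using assms by (intro nambu_reduction.intro nambu_reduction_axioms.intro) auto
  show ?thesis
  proof (intro bexI[OF _ qbr_funcset] conjI ballI impI)
    show "nambu_ring n Q qbr"
      by (rule nambu_ring_qbr)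
    show "incl_quot R D I (qbr (map \<pi> bs)) = (D \<inter> I) +> br bs" if "bs \<in> tuples n B" for bs
      using that by (rule incl_quot_qbr)
    show "f = qbr" if "f \<in> tuples n (carrier Q) \<rightarrow>\<^sub>E carrier Q"
      and "\<forall>bs \<in> tuples n B. incl_quot R D I (f (map \<pi> bs)) = (D \<inter> I) +> br bs" for f
      using that by (intro qbr_unique) auto
  qed
qed

end
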